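(* Let $m,n$ be integers with $\min(m,n)\ge 2$, let $a\in\mathbb{R}_+^m$ and $b\in\mathbb{R}_+^n$ be probability vectors with (strictly) positive entries, let $K\in\mathbb{R}_+^{m\times n}$ be a matrix with (strictly) positive entries, and let $\Lambda=\Lambda(K)$ be the Birkhoff contraction ratio of $K$. Then for every $\omega$ with $0<\omega<\frac{2}{1+\Lambda}$, the modified Sinkhorn algorithm on $\mathcal{C}^m\times\mathcal{C}^n$, $$\underline{u}_{\ell+1}=(1-\omega)\cdot\underline{u}_\ell+\omega\cdot\underline{a}-\omega\cdot\underline{Kv_\ell},\qquad \underline{v}_{\ell+1}=(1-\omega)\cdot\underline{v}_\ell+\omega\cdot\underline{b}-\omega\cdot\underline{K^{\mathsf T}u_{\ell+1}},$$ converges, for any starting point $(\underline{u}_0,\underline{v}_0)\in\mathcal{C}^m\times\mathcal{C}^n$, to $(\underline{u}^*,\underline{v}^* )$ exponentially fast; that is, there exist constants $C\ge 0$ and $q\in(0,1)$ such that $\|\underline{u}_\ell-\underline{u}^*\|_H+\|\underline{v}_\ell-\underline{v}^*\|_H\le C q^\ell$ for all $\ell\ge 0$.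
   Context: $\mathbb{R}_+$ denotes the (strictly) positive reals. For vectors of equal dimension, $x\circ y$ is the componentwise product; powers of vectors are componentwise. Compositional data space: $\mathcal{C}^m=\mathbb{R}_+^m/\!\sim$, where $x\sim x'$ iff $x=tx'$ for some $t>0$; the class of $x$ is denoted $\underline{x}$. With $\underline{x}+\underline{y}:=\underline{x\circ y}$ and $\gamma\cdot\underline{x}:=\underline{x^\gamma}$ ($\gamma\in\mathbb{R}$) it is a real vector space of dimension $m-1$, equipped with the Hilbert norm $\|\underline{x}\|_H=\log\max_{i,j}\frac{x_i}{x_j}$; $\mathcal{C}^n$ is defined analogously. The classes $\underline{Kv}\in\mathcal{C}^m$ and $\underline{K^{\mathsf T}u}\in\mathcal{C}^n$ depend only on $\underline{v}$ and $\underline{u}$, respectively. The pair $(u^*,v^* )\in\mathbb{R}_+^m\times\mathbb{R}_+^n$ denotes a solution of $u\circ Kv=a$, $v\circ K^{\mathsf T}u=b$, which by a classical theorem of Sinkhorn exists and is unique up to rescaling $(tu^*,t^{-1}v^* )$, $t>0$; hence $(\underline{u}^*,\underline{v}^* )$ is well defined. Birkhoff contraction ratio: $\eta(K)=\max_{i,j,k,\ell}\frac{K_{ik}K_{j\ell}}{K_{jk}K_{i\ell}}$ and $\Lambda(K)=\frac{\sqrt{\eta(K)}-1}{\sqrt{\eta(K)}+1}$. *)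

theory Defs
  imports "HOL-Analysis.Analysis"
begin

definition pos_vec :: "real ^ 'n \<Rightarrow> bool" where
  "pos_vec x \<longleftrightarrow> (\<forall>i. 0 < x $ i)"

definition pos_mat :: "real ^ 'n ^ 'm \<Rightarrow> bool" where
  "pos_mat K \<longleftrightarrow> (\<forall>i j. 0 < K $ i $ j)"

definition comp_rel :: "real ^ 'n \<Rightarrow> real ^ 'n \<Rightarrow> bool" where
  "comp_rel x x' \<longleftrightarrow> pos_vec x \<and> pos_vec x' \<and> (\<exists>t>0. x = t *\<^sub>R x')"

lemma comp_relE:
  assumes "comp_rel x y"
  obtains t where "0 < t" "\<And>i. x $ i = t * y $ i" "\<And>i. 0 < x $ i" "\<And>i. 0 < y $ i"
proof -
  from assms obtain t where "0 < t" "x = t *\<^sub>R y" "pos_vec x" "pos_vec y"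
    unfolding comp_rel_def by blast
  then show thesis by (intro that[of t]) (simp_all add: pos_vec_def)
qed

lemma comp_rel_reflD:
  assumes "comp_rel x x"
  shows "0 < x $ i" "0 \<le> x $ i" "x $ i \<noteq> 0"
proof -
  show *: "0 < x $ i" using assms unfolding comp_rel_def pos_vec_def by simp
  then show "0 \<le> x $ i" "x $ i \<noteq> 0" by simp_all
qed

lemma comp_relI:
  assumes "0 < t" "\<And>i. x $ i = t * y $ i" "\<And>i. 0 < y $ i"
  shows "comp_rel x y"
  unfolding comp_rel_def pos_vec_def
  using assms by (auto simp: vec_eq_iff intro!: exI[of _ t])

lemma part_equivp_comp_rel: "part_equivp (comp_rel :: real ^ 'n \<Rightarrow> real ^ 'n \<Rightarrow> bool)"
proof (rule part_equivpI)
  show "\<exists>x :: real ^ 'n. comp_rel x x"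
    by (rule exI[of _ "\<chi> i. 1"], rule comp_relI[of 1]) auto
  show "symp (comp_rel :: real ^ 'n \<Rightarrow> real ^ 'n \<Rightarrow> bool)"
  proof (rule sympI)
    fix x y :: "real ^ 'n" assume "comp_rel x y"
    then obtain t where "0 < t" "\<And>i. x $ i = t * y $ i" "\<And>i. 0 < x $ i" "\<And>i. 0 < y $ i"
      by (rule comp_relE) blast
    then show "comp_rel y x"
      by (intro comp_relI[of "inverse t"]) (auto simp flip: mult.assoc)
  qed
  show "transp (comp_rel :: real ^ 'n \<Rightarrow> real ^ 'n \<Rightarrow> bool)"
  proof (rule transpI)
    fix x y z :: "real ^ 'n" assume "comp_rel x y" "comp_rel y z"
    from \<open>comp_rel x y\<close> obtain s where "0 < s" "\<And>i. x $ i = s * y $ i"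
      by (rule comp_relE) blast
    moreover from \<open>comp_rel y z\<close> obtain t where
      "0 < t" "\<And>i. y $ i = t * z $ i" "\<And>i. 0 < z $ i"
      by (rule comp_relE) blast
    ultimately show "comp_rel x z" by (intro comp_relI[of "s * t"]) auto
  qed
qed

text \<open>
  The relation is partial: only vectors with positive entries represent a class, and
  \<open>cls x\<close> is meaningful only if \<open>pos_vec x\<close>.
\<close>

quotient_type 'n compositional = "real ^ 'n" / partial: comp_rel
  morphisms rep cls
  by (rule part_equivp_comp_rel)

lemma pos_vec_iff_comp_rel: "pos_vec x \<longleftrightarrow> comp_rel x x"
  unfolding comp_rel_def by (auto intro!: exI[of _ 1])

lemma cls_eq_iff:
  assumes "pos_vec x" "pos_vec y"
  shows "cls x = cls y \<longleftrightarrow> (\<exists>t>0. x = t *\<^sub>R y)"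
proof -
  have "comp_rel x y \<longleftrightarrow> cls x = cls y"
    using Quotient_rel[OF Quotient_compositional, of x y] assms
    unfolding pos_vec_iff_comp_rel by blast
  then show ?thesis using assms unfolding comp_rel_def by blast
qed

lemma pos_vec_rep: "pos_vec (rep x)"
  unfolding pos_vec_iff_comp_rel by (rule Quotient_rep_reflp[OF Quotient_compositional])

lemma cls_rep: "cls (rep x) = x"
  by (rule Quotient_abs_rep[OF Quotient_compositional])

lemma compositional_cases:
  obtains y where "x = cls y" "pos_vec y"
  using cls_rep pos_vec_rep by metis

instantiation compositional :: (finite) real_vector
begin

lift_definition zero_compositional :: "'a compositional" is "\<chi> i. 1"
  by (rule comp_relI[of 1]) auto

lift_definition plus_compositional :: "'a compositional \<Rightarrow> 'a compositional \<Rightarrow> 'a compositional"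
  is "\<lambda>x y. x * y"
proof (elim comp_relE)
  fix x x' y y' :: "real ^ 'a" and s t
  assume "0 < s" "0 < t" "\<And>i. x $ i = s * x' $ i" "\<And>i. y $ i = t * y' $ i"
    "\<And>i. 0 < x' $ i" "\<And>i. 0 < y' $ i"
  then show "comp_rel (x * y) (x' * y')"
    by (intro comp_relI[of "s * t"]) auto
qed

lift_definition scaleR_compositional :: "real \<Rightarrow> 'a compositional \<Rightarrow> 'a compositional"
  is "\<lambda>c x. \<chi> i. (x $ i) powr c"
proof (elim comp_relE)
  fix c and x x' :: "real ^ 'a" and t
  assume *: "0 < t" "\<And>i. x $ i = t * x' $ i" "\<And>i. 0 < x' $ i"
  have "0 \<le> x' $ i" for i using *(3)[of i] by simp
  moreover have "x' $ i \<noteq> 0" for i using *(3)[of i] by simp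
  ultimately show "comp_rel (\<chi> i. (x $ i) powr c) (\<chi> i. (x' $ i) powr c)"
    using * by (intro comp_relI[of "t powr c"]) (auto simp: powr_mult)
qed

definition uminus_compositional :: "'a compositional \<Rightarrow> 'a compositional" where
  "- x = (- 1) *\<^sub>R x" for x :: "'a compositional"

definition minus_compositional :: "'a compositional \<Rightarrow> 'a compositional \<Rightarrow> 'a compositional" where
  "x - y = x + - y" for x y :: "'a compositional"

instance
proof
  fix x y z :: "'a compositional" and c d :: real
  show "x + y + z = x + (y + z)"
    by transfer (rule comp_relI[of 1]; simp add: comp_rel_reflD mult.assoc)
  show "x + y = y + x"
    by transfer (rule comp_relI[of 1]; simp add: comp_rel_reflD mult.commute)
  show "0 + x = x"
    by transfer (rule comp_relI[of 1]; simp add: comp_rel_reflD)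
  show "c *\<^sub>R (x + y) = c *\<^sub>R x + c *\<^sub>R y"
    by transfer (rule comp_relI[of 1]; simp add: comp_rel_reflD powr_mult)
  show "(c + d) *\<^sub>R x = c *\<^sub>R x + d *\<^sub>R x"
    by transfer (rule comp_relI[of 1]; simp add: comp_rel_reflD powr_add)
  show "c *\<^sub>R d *\<^sub>R x = (c * d) *\<^sub>R x"
    by transfer (rule comp_relI[of 1]; simp add: comp_rel_reflD powr_powr mult.commute)
  show "1 *\<^sub>R x = x"
    by transfer (rule comp_relI[of 1]; simp add: comp_rel_reflD)
  show "- x + x = 0"
    unfolding uminus_compositional_def
    by transfer (rule comp_relI[of 1]; simp add: comp_rel_reflD powr_minus)
  show "x - y = x + - y" by (rule minus_compositional_def)
qed

end

lemma cls_add: "pos_vec x \<Longrightarrow> pos_vec y \<Longrightarrow> cls x + cls y = cls (x * y)"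
  by (simp add: plus_compositional.abs_eq pos_vec_iff_comp_rel)

lemma scaleR_cls: "pos_vec x \<Longrightarrow> c *\<^sub>R cls x = cls (\<chi> i. (x $ i) powr c)"
  by (simp add: scaleR_compositional.abs_eq pos_vec_iff_comp_rel)

text \<open>The norm of \<open>'n compositional\<close> is the Hilbert norm.\<close>

lift_definition hilbert_norm :: "'n::finite compositional \<Rightarrow> real"
  is "\<lambda>x. ln (Max (range (\<lambda>(i, j). x $ i / x $ j)))"
proof (elim comp_relE)
  fix x x' :: "real ^ 'n" and t
  assume "0 < t" "\<And>i. x $ i = t * x' $ i" "\<And>i. 0 < x' $ i"
  then show "ln (Max (range (\<lambda>(i, j). x $ i / x $ j))) = ln (Max (range (\<lambda>(i, j). x' $ i / x' $ j)))"
    by simp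
qed

lemma hilbert_norm_cls:
  assumes "pos_vec x"
  shows "hilbert_norm (cls x) = ln (Max (range (\<lambda>(i, j). x $ i / x $ j)))"
  using assms by (simp add: hilbert_norm.abs_eq pos_vec_iff_comp_rel)

lemma hilbert_norm_ge:
  assumes "pos_vec x"
  shows "ln (x $ i) - ln (x $ j) \<le> hilbert_norm (cls x)"
proof -
  have p: "0 < x $ k" for k using assms by (simp add: pos_vec_def)
  have "x $ i / x $ j \<le> Max (range (\<lambda>(i, j). x $ i / x $ j))"
    by (rule Max_ge) (auto intro: range_eqI[of _ _ "(i, j)"])
  then have "ln (x $ i / x $ j) \<le> hilbert_norm (cls x)"
    using p[of i] p[of j] unfolding hilbert_norm_cls[OF assms]
    by (intro ln_mono) (auto intro: divide_pos_pos)
  then show ?thesis using p[of i] p[of j] by (simp add: ln_div)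
qed

lemma hilbert_norm_attained:
  assumes "pos_vec x"
  obtains i j where "hilbert_norm (cls x) = ln (x $ i) - ln (x $ j)"
proof -
  have p: "0 < x $ k" for k using assms by (simp add: pos_vec_def)
  have "Max (range (\<lambda>(i, j). x $ i / x $ j)) \<in> range (\<lambda>(i, j). x $ i / x $ j)"
    by (rule Max_in) auto
  then obtain i j where "Max (range (\<lambda>(i, j). x $ i / x $ j)) = x $ i / x $ j" by fast
  then have "hilbert_norm (cls x) = ln (x $ i) - ln (x $ j)"
    unfolding hilbert_norm_cls[OF assms] using p[of i] p[of j] by (simp add: ln_div)
  then show ?thesis by (rule that)
qed

instantiation compositional :: (finite) real_normed_vector
begin

definition norm_compositional :: "'a compositional \<Rightarrow> real" where
  "norm_compositional = hilbert_norm"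

definition sgn_compositional :: "'a compositional \<Rightarrow> 'a compositional" where
  "sgn x = x /\<^sub>R norm x" for x :: "'a compositional"

definition dist_compositional :: "'a compositional \<Rightarrow> 'a compositional \<Rightarrow> real" where
  "dist x y = norm (x - y)" for x y :: "'a compositional"

definition uniformity_compositional :: "('a compositional \<times> 'a compositional) filter" where
  "(uniformity :: ('a compositional \<times> 'a compositional) filter) =
    (INF e\<in>{0<..}. principal {(x, y). dist x y < e})"

definition open_compositional :: "'a compositional set \<Rightarrow> bool" where
  "open U \<longleftrightarrow> (\<forall>x\<in>U. \<forall>\<^sub>F (x', y) in uniformity. x' = x \<longrightarrow> y \<in> U)" for U :: "'a compositional set"

instance
proof
  fix x y :: "'a compositional" and c :: real and U :: "'a compositional set"
  show "dist x y = norm (x - y)" by (rule dist_compositional_def)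
  show "sgn x = x /\<^sub>R norm x" by (rule sgn_compositional_def)
  show "(uniformity :: ('a compositional \<times> 'a compositional) filter) =
      (INF e\<in>{0<..}. principal {(x, y). dist x y < e})"
    by (rule uniformity_compositional_def)
  show "open U \<longleftrightarrow> (\<forall>x\<in>U. \<forall>\<^sub>F (x', y) in uniformity. x' = x \<longrightarrow> y \<in> U)"
    by (rule open_compositional_def)
  obtain x0 where x: "x = cls x0" "pos_vec x0" by (rule compositional_cases)
  obtain y0 where y: "y = cls y0" "pos_vec y0" by (rule compositional_cases)
  have px: "0 < x0 $ i" for i using x(2) by (simp add: pos_vec_def)
  have py: "0 < y0 $ i" for i using y(2) by (simp add: pos_vec_def)
  show "norm x = 0 \<longleftrightarrow> x = 0"
  proof
    assume "norm x = 0"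
    then have le: "ln (x0 $ i) \<le> ln (x0 $ j)" for i j
      using hilbert_norm_ge[OF x(2), of i j] x(1) by (simp add: norm_compositional_def)
    have eq: "x0 $ i = x0 $ j" for i j
      using le[of i j] le[of j i] px[of i] px[of j] by simp
    obtain k :: 'a where True by auto
    have "comp_rel x0 (\<chi> i. 1)"
      by (rule comp_relI[of "x0 $ k"]) (use px eq in auto)
    then show "x = 0"
      using x by (simp add: zero_compositional_def cls_eq_iff comp_rel_def)
  next
    assume "x = 0"
    then show "norm x = 0"
      unfolding norm_compositional_def by (simp, transfer) (simp add: case_prod_beta')
  qed
  show "norm (x + y) \<le> norm x + norm y"
  proof -
    have pxy: "pos_vec (x0 * y0)" using px py by (simp add: pos_vec_def)
    obtain i j where "hilbert_norm (cls (x0 * y0)) = ln ((x0 * y0) $ i) - ln ((x0 * y0) $ j)"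
      using hilbert_norm_attained[OF pxy] .
    also have "\<dots> = (ln (x0 $ i) - ln (x0 $ j)) + (ln (y0 $ i) - ln (y0 $ j))"
      using px[of i] px[of j] py[of i] py[of j] by (simp add: ln_mult)
    also have "\<dots> \<le> hilbert_norm (cls x0) + hilbert_norm (cls y0)"
      by (intro add_mono hilbert_norm_ge x(2) y(2))
    finally show ?thesis
      using x y by (simp add: norm_compositional_def cls_add)
  qed
  show "norm (c *\<^sub>R x) = \<bar>c\<bar> * norm x"
  proof -
    let ?z = "\<chi> i. (x0 $ i) powr c"
    have pz: "pos_vec ?z" unfolding pos_vec_def
      using px by (metis less_numeral_extra(3) powr_gt_zero vec_lambda_beta)
    have lnz: "ln (?z $ i) = c * ln (x0 $ i)" for i
      using px[of i] by simp
    have sw: "\<bar>c\<bar> * (ln (x0 $ i) - ln (x0 $ j)) =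
        (if 0 \<le> c then ln (?z $ i) - ln (?z $ j) else ln (?z $ j) - ln (?z $ i))" for i j
      unfolding lnz by (simp add: algebra_simps)
    have "hilbert_norm (cls ?z) \<le> \<bar>c\<bar> * hilbert_norm (cls x0)"
    proof -
      obtain i j where ij: "hilbert_norm (cls ?z) = ln (?z $ i) - ln (?z $ j)"
        using hilbert_norm_attained[OF pz] .
      have "ln (?z $ i) - ln (?z $ j) \<le> \<bar>c\<bar> * hilbert_norm (cls x0)"
      proof (cases "0 \<le> c")
        case True
        then show ?thesis
          using sw[of i j] mult_left_mono[OF hilbert_norm_ge[OF x(2), of i j], of "\<bar>c\<bar>"] by simp
      next
        case False
        then show ?thesis
          using sw[of j i] mult_left_mono[OF hilbert_norm_ge[OF x(2), of j i], of "\<bar>c\<bar>"] by simp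
      qed
      then show ?thesis using ij by simp
    qed
    moreover have "\<bar>c\<bar> * hilbert_norm (cls x0) \<le> hilbert_norm (cls ?z)"
    proof -
      obtain i j where ij: "hilbert_norm (cls x0) = ln (x0 $ i) - ln (x0 $ j)"
        using hilbert_norm_attained[OF x(2)] .
      show ?thesis
        unfolding ij sw using hilbert_norm_ge[OF pz, of i j] hilbert_norm_ge[OF pz, of j i] by auto
    qed
    ultimately show ?thesis
      using x by (simp add: norm_compositional_def scaleR_cls)
  qed
qed

end

lemma norm_cls: "pos_vec x \<Longrightarrow> norm (cls x) = ln (Max (range (\<lambda>(i, j). x $ i / x $ j)))"
  by (simp add: norm_compositional_def hilbert_norm_cls)

lemma pos_vec_mat_mult:
  fixes K :: "real ^ 'n::finite ^ 'm::finite"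
  assumes "pos_mat K" "pos_vec v"
  shows "pos_vec (K *v v)"
  using assms unfolding pos_vec_def pos_mat_def matrix_vector_mult_def
  by (auto intro!: sum_pos)

text \<open>
  The class of \<open>K v\<close> as a function of the class of \<open>v\<close>. It is independent of the representative
  only for matrices with positive entries.
\<close>

definition mat_cls :: "real ^ 'n ^ 'm \<Rightarrow> 'n::finite compositional \<Rightarrow> 'm::finite compositional" where
  "mat_cls K v = cls (K *v rep v)"

lemma mat_cls_cls:
  assumes "pos_mat K" "pos_vec v"
  shows "mat_cls K (cls v) = cls (K *v v)"
proof -
  obtain t where t: "0 < t" "rep (cls v) = t *\<^sub>R v"
    using cls_eq_iff[OF pos_vec_rep assms(2), of "cls v"] cls_rep[of "cls v"] by auto
  have "K *v rep (cls v) = t *\<^sub>R (K *v v)"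
    by (simp add: t(2) matrix_vector_mult_scaleR)
  moreover have pos: "pos_vec (K *v v)" using assms by (rule pos_vec_mat_mult)
  moreover have "pos_vec (t *\<^sub>R (K *v v))" using pos t(1) by (simp add: pos_vec_def)
  ultimately show ?thesis
    unfolding mat_cls_def using t(1) by (auto simp: cls_eq_iff)
qed

definition birkhoff_eta :: "real ^ 'n ^ 'm \<Rightarrow> real" where
  "birkhoff_eta K = Max (range (\<lambda>(i, j, k, l). (K $ i $ k * K $ j $ l) / (K $ j $ k * K $ i $ l)))"

definition birkhoff_ratio :: "real ^ 'n ^ 'm \<Rightarrow> real" where
  "birkhoff_ratio K = (sqrt (birkhoff_eta K) - 1) / (sqrt (birkhoff_eta K) + 1)"

definition prob_vec :: "real ^ 'n \<Rightarrow> bool" where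
  "prob_vec x \<longleftrightarrow> (\<forall>i. 0 \<le> x $ i) \<and> (\<Sum>i\<in>UNIV. x $ i) = 1"

definition sinkhorn_solution ::
    "real ^ 'n ^ 'm \<Rightarrow> real ^ 'm \<Rightarrow> real ^ 'n \<Rightarrow> real ^ 'm \<Rightarrow> real ^ 'n \<Rightarrow> bool" where
  "sinkhorn_solution K a b u v \<longleftrightarrow>
     pos_vec u \<and> pos_vec v \<and> u * (K *v v) = a \<and> v * (transpose K *v u) = b"

lemma sinkhorn_solution_exists:
  fixes K :: "real ^ 'n ^ 'm"
  assumes K: "pos_mat K" and a: "pos_vec a" and b: "pos_vec b"
    and sum_eq: "(\<Sum>i\<in>UNIV. a $ i) = (\<Sum>j\<in>UNIV. b $ j)"
  shows "\<exists>u v. sinkhorn_solution K a b u v"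
proof -
  define S where "S = {x :: real ^ 'm. (\<forall>i. 0 \<le> x $ i) \<and> (\<Sum>i\<in>UNIV. x $ i) = 1}"
  define y where "y = (\<lambda>x. transpose K *v x)"
  define z where "z = (\<lambda>x. \<chi> j. b $ j / y x $ j)"
  define w where "w = (\<lambda>x. \<chi> i. a $ i / (K *v z x) $ i)"
  define T where "T = (\<lambda>x. (1 / (\<Sum>i\<in>UNIV. w x $ i)) *\<^sub>R w x)"
  have ypos: "0 < y x $ j" if "x \<in> S" for x j
  proof -
    have "\<exists>i. x $ i \<noteq> 0"
    proof (rule ccontr)
      assume "\<not> (\<exists>i. x $ i \<noteq> 0)"
      then show False using that by (simp add: S_def)
    qed
    then obtain i where "x $ i \<noteq> 0" by blast
    moreover have "0 \<le> x $ i" using that by (simp add: S_def)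
    ultimately have "0 < x $ i" by simp
    then have "0 < (\<Sum>i\<in>UNIV. K $ i $ j * x $ i)"
      using that K by (intro sum_pos2[of _ i]) (auto simp: S_def pos_mat_def less_imp_le)
    then show ?thesis by (simp add: y_def matrix_vector_mult_def transpose_def)
  qed
  have zpos: "pos_vec (z x)" if "x \<in> S" for x
    using ypos[OF that] b by (simp add: z_def pos_vec_def)
  have Kzpos: "0 < (K *v z x) $ i" if "x \<in> S" for x i
    using pos_vec_mat_mult[OF K zpos[OF that]] by (simp add: pos_vec_def)
  have wpos: "0 < w x $ i" if "x \<in> S" for x i
    using Kzpos[OF that] a by (simp add: w_def pos_vec_def)
  have swpos: "0 < (\<Sum>i\<in>UNIV. w x $ i)" if "x \<in> S" for x
    using wpos[OF that] by (intro sum_pos) auto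
  have "compact S"
  proof -
    have "S = (\<Inter>i. {x. 0 \<le> x $ i}) \<inter> {x. (\<Sum>i\<in>UNIV. x $ i) = 1}"
      by (auto simp: S_def)
    also have "closed \<dots>"
      by (intro closed_Int closed_INT ballI closed_Collect_le closed_Collect_eq continuous_intros)
    finally have "closed S" .
    moreover have "bounded S"
    proof (rule boundedI)
      fix x assume "x \<in> S"
      then show "norm x \<le> 1" using norm_le_l1_cart[of x] by (simp add: S_def)
    qed
    ultimately show ?thesis by (simp add: compact_eq_bounded_closed)
  qed
  moreover have "convex S"
    unfolding convex_def S_def
    by (auto simp: sum.distrib sum_distrib_left[symmetric])
  moreover have "S \<noteq> {}"
  proof -
    have "(\<chi> i. 1 / real CARD('m)) \<in> S" by (simp add: S_def)
    then show ?thesis by blast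
  qed
  moreover have "continuous_on S T"
  proof -
    have "continuous_on S y"
      unfolding y_def by (rule matrix_vector_mult_linear_continuous_on)
    then have "continuous_on S z"
      unfolding z_def using ypos by (intro continuous_intros) (metis less_irrefl)+
    then have "continuous_on S (\<lambda>x. K *v z x)"
      using continuous_on_compose2[OF matrix_vector_mult_linear_continuous_on[of UNIV K]] by blast
    then have "continuous_on S w"
      unfolding w_def using Kzpos by (intro continuous_intros) (metis less_irrefl)+
    then show ?thesis
      unfolding T_def using swpos by (intro continuous_intros) (metis less_irrefl)+
  qed
  moreover have "T ` S \<subseteq> S"
  proof
    fix p assume "p \<in> T ` S"
    then obtain x where x: "x \<in> S" "p = T x" by auto
    show "p \<in> S"
      unfolding x(2) T_def S_def using wpos[OF x(1)] swpos[OF x(1)]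
      by (auto simp: less_imp_le sum_divide_distrib[symmetric])
  qed
  ultimately obtain x where x: "x \<in> S" "T x = x"
    using brouwer[of S T] by blast
  define s where "s = 1 / (\<Sum>i\<in>UNIV. w x $ i)"
  have "0 < s" using swpos[OF x(1)] by (simp add: s_def)
  have xi: "x $ i = s * w x $ i" for i
    using x(2) by (simp add: T_def s_def vec_eq_iff)
  have uK: "x $ i * (K *v z x) $ i = s * a $ i" for i
    using Kzpos[OF x(1), of i] unfolding xi by (simp add: w_def)
  have vK: "z x $ j * y x $ j = b $ j" for j
    using ypos[OF x(1), of j] by (simp add: z_def)
  have "s * (\<Sum>i\<in>UNIV. a $ i) = (\<Sum>i\<in>UNIV. x $ i * (K *v z x) $ i)"
    by (simp add: uK sum_distrib_left)
  also have "\<dots> = (\<Sum>i\<in>UNIV. \<Sum>j\<in>UNIV. z x $ j * (K $ i $ j * x $ i))"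
    by (simp add: matrix_vector_mult_def sum_distrib_left mult_ac)
  also have "\<dots> = (\<Sum>j\<in>UNIV. \<Sum>i\<in>UNIV. z x $ j * (K $ i $ j * x $ i))"
    by (rule sum.swap)
  also have "\<dots> = (\<Sum>j\<in>UNIV. z x $ j * y x $ j)"
    by (simp add: y_def matrix_vector_mult_def transpose_def sum_distrib_left)
  also have "\<dots> = (\<Sum>i\<in>UNIV. a $ i)"
    by (simp add: vK sum_eq)
  finally have "s * (\<Sum>i\<in>UNIV. a $ i) = (\<Sum>i\<in>UNIV. a $ i)" .
  moreover have "0 < (\<Sum>i\<in>UNIV. a $ i)"
    using a by (intro sum_pos) (auto simp: pos_vec_def)
  ultimately have "s = 1" by simp
  have "pos_vec x"
    unfolding pos_vec_def xi using \<open>0 < s\<close> wpos[OF x(1)] by simp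
  then have "sinkhorn_solution K a b x (z x)"
    unfolding sinkhorn_solution_def using zpos[OF x(1)] uK vK \<open>s = 1\<close>
    by (simp add: vec_eq_iff y_def)
  then show ?thesis by blast
qed

end

theory Submission
  imports Defs
begin

text \<open>
  By the Birkhoff contraction theorem, \<open>K\<close> and its transpose are \<open>\<Lambda>\<close>-Lipschitz for the Hilbert norm.
  The errors \<open>X, Y\<close> of the two components therefore satisfy \<open>X' \<le> \<bar>1 - \<omega>\<bar> X + \<omega>\<Lambda> Y\<close> and
  \<open>Y' \<le> \<bar>1 - \<omega>\<bar> Y + \<omega>\<Lambda> X'\<close>, so \<open>max X Y\<close> shrinks by the factor \<open>\<bar>1 - \<omega>\<bar> + \<omega>\<Lambda>\<close>, which is
  less than \<open>1\<close> exactly when \<open>0 < \<omega> < 2 / (1 + \<Lambda>)\<close>.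

  The contraction theorem is proved by moving from \<open>w\<close> to \<open>v\<close> along the geodesic \<open>w \<circ> exp (t z)\<close>.
  The derivative of \<open>ln (K v)\<^sub>i - ln (K v)\<^sub>j\<close> is a difference of means of \<open>z\<close> under two probability
  vectors with likelihood ratios bounded by \<open>\<eta>\<close>; it is at most the total variation distance times
  the oscillation of \<open>z\<close>, and the total variation distance is at most \<open>\<Lambda>\<close>.
\<close>

section \<open>Total variation bounds from likelihood ratios\<close>

text \<open>
  With \<open>x = sqrt (P (1 - Q))\<close> and \<open>y = sqrt (Q (1 - P))\<close> one has \<open>P - Q = x\<^sup>2 - y\<^sup>2\<close>, \<open>x + y \<le> 1\<close>
  and \<open>x \<le> s y\<close>.
\<close>

lemma diff_le_of_odds_ratio_le:
  fixes P Q s :: real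
  assumes P: "0 \<le> P" "P \<le> 1" and Q: "0 \<le> Q" "Q \<le> 1" and s: "1 \<le> s"
    and odds: "P * (1 - Q) \<le> s\<^sup>2 * (Q * (1 - P))"
  shows "P - Q \<le> (s - 1) / (s + 1)"
proof -
  define x where "x = sqrt (P * (1 - Q))"
  define y where "y = sqrt (Q * (1 - P))"
  have nonneg: "0 \<le> x" "0 \<le> y"
    using P Q by (simp_all add: x_def y_def)
  have sq: "x\<^sup>2 = P * (1 - Q)" "y\<^sup>2 = Q * (1 - P)"
    using P Q by (simp_all add: x_def y_def)
  have "x \<le> s * y"
    by (rule power2_le_imp_le) (use odds sq nonneg s in \<open>simp_all add: power_mult_distrib\<close>)
  have "x \<le> (P + (1 - Q)) / 2" "y \<le> (Q + (1 - P)) / 2"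
    unfolding x_def y_def using P Q by (intro arith_geo_mean_sqrt; simp)+
  then have "x + y \<le> 1"
    by argo
  have "(s + 1) * (x - y) \<le> (s - 1) * (x + y)"
    using \<open>x \<le> s * y\<close> by (simp add: algebra_simps)
  then have "x - y \<le> (s - 1) / (s + 1) * (x + y)"
    using s by (simp add: field_simps)
  then have "(x - y) * (x + y) \<le> (s - 1) / (s + 1) * (x + y) * (x + y)"
    using nonneg by (intro mult_right_mono) auto
  also have "\<dots> = (s - 1) / (s + 1) * (x + y)\<^sup>2"
    by (simp add: power2_eq_square)
  also have "\<dots> \<le> (s - 1) / (s + 1)"
    using nonneg \<open>x + y \<le> 1\<close> s by (intro mult_left_le) (auto intro: power_le_one)
  also have "(x - y) * (x + y) = P - Q"
    using sq by (simp add: algebra_simps power2_eq_square)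
  finally show ?thesis .
qed

lemma mean_diff_le_of_likelihood_ratio_le:
  fixes p q z :: "'a \<Rightarrow> real" and s D :: real
  assumes I: "finite I" "I \<noteq> {}" and s: "1 \<le> s"
    and p: "\<And>k. k \<in> I \<Longrightarrow> 0 < p k" and q: "\<And>k. k \<in> I \<Longrightarrow> 0 < q k"
    and ratio: "\<And>k l. k \<in> I \<Longrightarrow> l \<in> I \<Longrightarrow> p k * q l \<le> s\<^sup>2 * (q k * p l)"
    and osc: "\<And>k l. k \<in> I \<Longrightarrow> l \<in> I \<Longrightarrow> z k - z l \<le> D"
  shows "(\<Sum>k\<in>I. p k * z k) / (\<Sum>k\<in>I. p k) - (\<Sum>k\<in>I. q k * z k) / (\<Sum>k\<in>I. q k)
    \<le> (s - 1) / (s + 1) * D"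
proof -
  define Sp where "Sp = (\<Sum>k\<in>I. p k)"
  define Sq where "Sq = (\<Sum>k\<in>I. q k)"
  have pos: "0 < Sp" "0 < Sq"
    unfolding Sp_def Sq_def using I p q by (auto intro: sum_pos)
  define d where "d = (\<lambda>k. p k / Sp - q k / Sq)"
  \<comment> \<open>On \<open>A\<close> the first normalised weight dominates, so
    \<open>P - Q\<close> is the total variation distance of the two distributions.\<close>
  define A where "A = {k \<in> I. 0 \<le> d k}"
  have A: "finite A" "A \<subseteq> I"
    using I by (auto simp: A_def)
  define P where "P = (\<Sum>k\<in>A. p k) / Sp"
  define Q where "Q = (\<Sum>k\<in>A. q k) / Sq"
  have compl: "1 - P = (\<Sum>k\<in>I - A. p k) / Sp" "1 - Q = (\<Sum>k\<in>I - A. q k) / Sq"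
    using pos sum_diff[OF I(1) A(2), of p] sum_diff[OF I(1) A(2), of q]
    by (simp_all add: P_def Q_def Sp_def Sq_def diff_divide_distrib)
  have nonneg: "0 \<le> P" "0 \<le> Q" "0 \<le> 1 - P" "0 \<le> 1 - Q"
    unfolding compl unfolding P_def Q_def using A pos p q
    by (auto intro!: divide_nonneg_pos sum_nonneg intro: less_imp_le)
  \<comment> \<open>Summing \<open>ratio\<close> over pairs in \<open>A\<close> and its complement
    turns the pointwise bound into an odds ratio bound for the event \<open>A\<close>.\<close>
  have "(\<Sum>k\<in>A. p k) * (\<Sum>l\<in>I - A. q l) = (\<Sum>k\<in>A. \<Sum>l\<in>I - A. p k * q l)"
    by (simp add: sum_product)
  also have "\<dots> \<le> (\<Sum>k\<in>A. \<Sum>l\<in>I - A. s\<^sup>2 * (q k * p l))"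
    using A by (intro sum_mono ratio) auto
  also have "\<dots> = s\<^sup>2 * ((\<Sum>k\<in>A. q k) * (\<Sum>l\<in>I - A. p l))"
    unfolding sum_product by (simp only: sum_distrib_left)
  finally have "P * (1 - Q) \<le> s\<^sup>2 * (Q * (1 - P))"
    unfolding compl unfolding P_def Q_def using pos by (simp add: divide_right_mono mult.commute)
  then have PQ: "P - Q \<le> (s - 1) / (s + 1)"
    using nonneg s by (intro diff_le_of_odds_ratio_le) auto
  obtain k0 where k0: "k0 \<in> I" "\<And>k. k \<in> I \<Longrightarrow> z k0 \<le> z k"
    using arg_min_if_finite[OF I, of z] not_le by metis
  have sum_d: "(\<Sum>k\<in>I. d k) = 0"
    using pos by (simp add: d_def sum_subtractf Sp_def Sq_def flip: sum_divide_distrib)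
  have "(\<Sum>k\<in>I. p k * z k) / Sp - (\<Sum>k\<in>I. q k * z k) / Sq = (\<Sum>k\<in>I. d k * z k)"
    by (simp add: d_def left_diff_distrib sum_subtractf sum_divide_distrib)
  also have "\<dots> = (\<Sum>k\<in>I. d k * (z k - z k0))"
    by (simp add: right_diff_distrib sum_subtractf sum_d flip: sum_distrib_right)
  also have "\<dots> \<le> (\<Sum>k\<in>A. d k * (z k - z k0))"
  proof -
    have "(\<Sum>k\<in>I - A. d k * (z k - z k0)) \<le> 0"
      using k0 by (intro sum_nonpos mult_nonpos_nonneg) (auto simp: A_def)
    then show ?thesis
      using sum.subset_diff[OF A(2) I(1), of "\<lambda>k. d k * (z k - z k0)"] by simp
  qed
  also have "\<dots> \<le> (\<Sum>k\<in>A. d k * D)"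
    using A osc k0 by (intro sum_mono mult_left_mono) (auto simp: A_def)
  also have "\<dots> = (P - Q) * D"
    by (simp add: d_def P_def Q_def sum_subtractf sum_divide_distrib flip: sum_distrib_right)
  \<comment> \<open>\<open>osc\<close> with both indices equal gives
    \<open>0 \<le> D\<close>.\<close>
  also have "\<dots> \<le> (s - 1) / (s + 1) * D"
    using PQ osc[OF k0(1) k0(1)] by (intro mult_right_mono) auto
  finally show ?thesis
    by (simp add: Sp_def Sq_def)
qed

text \<open>The weights \<open>w k * exp (t * z k)\<close> interpolate between \<open>w\<close> at
  \<open>t = 0\<close> and \<open>v\<close> at \<open>t = 1\<close>. The bound on mean differences
  holds uniformly in \<open>t\<close>, so the mean value theorem transfers it to the
  endpoints.\<close>

lemma ln_sum_ratio_le: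
  fixes c d v w :: "'a \<Rightarrow> real" and s D :: real
  assumes I: "finite I" "I \<noteq> {}" and s: "1 \<le> s"
    and c: "\<And>k. k \<in> I \<Longrightarrow> 0 < c k" and d: "\<And>k. k \<in> I \<Longrightarrow> 0 < d k"
    and v: "\<And>k. k \<in> I \<Longrightarrow> 0 < v k" and w: "\<And>k. k \<in> I \<Longrightarrow> 0 < w k"
    and ratio: "\<And>k l. k \<in> I \<Longrightarrow> l \<in> I \<Longrightarrow> c k * d l \<le> s\<^sup>2 * (d k * c l)"
    and osc: "\<And>k l. k \<in> I \<Longrightarrow> l \<in> I \<Longrightarrow> ln (v k / w k) - ln (v l / w l) \<le> D"
  shows "ln ((\<Sum>k\<in>I. c k * v k) / (\<Sum>k\<in>I. c k * w k))
    - ln ((\<Sum>k\<in>I. d k * v k) / (\<Sum>k\<in>I. d k * w k)) \<le> (s - 1) / (s + 1) * D"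
proof -
  define z where "z = (\<lambda>k. ln (v k / w k))"
  define g where "g = (\<lambda>e t. \<Sum>k\<in>I. e k * w k * exp (t * z k))"
  define g' where "g' = (\<lambda>e t. \<Sum>k\<in>I. e k * w k * exp (t * z k) * z k)"
  have gpos: "0 < g e t" if "\<And>k. k \<in> I \<Longrightarrow> 0 < e k" for e t
    unfolding g_def using I w that by (intro sum_pos) auto
  have "((\<lambda>t. ln (g c t) - ln (g d t)) has_real_derivative g' c t / g c t - g' d t / g d t) (at t)" for t
  proof -
    have "((\<lambda>t. g e t) has_real_derivative g' e t) (at t)" for e
      unfolding g_def g'_def by (auto intro!: derivative_eq_intros sum.cong simp: mult_ac)
    then show ?thesis
      using gpos[of c t] gpos[of d t] c d by (auto intro!: derivative_eq_intros)
  qed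
  then obtain t where
    t: "(ln (g c 1) - ln (g d 1)) - (ln (g c 0) - ln (g d 0)) = g' c t / g c t - g' d t / g d t"
    using MVT2[of 0 1 "\<lambda>t. ln (g c t) - ln (g d t)" "\<lambda>t. g' c t / g c t - g' d t / g d t"]
    by auto
  have "g' c t / g c t - g' d t / g d t \<le> (s - 1) / (s + 1) * D"
    unfolding g_def g'_def
  proof (rule mean_diff_le_of_likelihood_ratio_le[OF I s])
    fix k l assume kl: "k \<in> I" "l \<in> I"
    let ?e = "\<lambda>k. w k * exp (t * z k)"
    \<comment> \<open>Tilting multiplies both sides of \<open>ratio\<close> by the same factor, so
      the likelihood ratio bound does not depend on \<open>t\<close>.\<close>
    have "c k * d l * (?e k * ?e l) \<le> s\<^sup>2 * (d k * c l) * (?e k * ?e l)"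
      using w[OF kl(1)] w[OF kl(2)] by (intro mult_right_mono ratio kl) auto
    then show "c k * w k * exp (t * z k) * (d l * w l * exp (t * z l))
        \<le> s\<^sup>2 * (d k * w k * exp (t * z k) * (c l * w l * exp (t * z l)))"
      by (simp add: mult_ac)
  qed (use c d w osc in \<open>auto simp: z_def\<close>)
  moreover have "g e 1 = (\<Sum>k\<in>I. e k * v k)" "g e 0 = (\<Sum>k\<in>I. e k * w k)" for e
    unfolding g_def z_def using v w by (auto intro!: sum.cong simp: less_le)
  ultimately show ?thesis
    using t gpos[of c 0] gpos[of d 0] gpos[of c 1] gpos[of d 1] c d by (simp add: ln_div)
qed

section \<open>Birkhoff ratio and contraction in the Hilbert norm\<close>

lemma cls_diff:
  assumes "pos_vec x" "pos_vec y"
  shows "cls x - cls y = cls (\<chi> i. x $ i / y $ i)"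
proof -
  have "(\<chi> i. (y $ i) powr - 1) = (\<chi> i. inverse (y $ i))"
    using assms(2) by (simp add: vec_eq_iff pos_vec_def powr_minus less_imp_le)
  then have "- cls y = cls (\<chi> i. inverse (y $ i))"
    unfolding uminus_compositional_def scaleR_cls[OF assms(2)] by simp
  moreover have "pos_vec (\<chi> i. inverse (y $ i))"
    using assms by (simp add: pos_vec_def)
  moreover have "x * (\<chi> i. inverse (y $ i)) = (\<chi> i. x $ i / y $ i)"
    by (simp add: vec_eq_iff divide_inverse)
  ultimately show ?thesis
    using assms(1) unfolding minus_compositional_def by (simp add: cls_add)
qed

lemma birkhoff_eta_ge: "(K $ i $ k * K $ j $ l) / (K $ j $ k * K $ i $ l) \<le> birkhoff_eta K"
  for K :: "real ^ 'n::finite ^ 'm::finite"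
  unfolding birkhoff_eta_def
  by (rule Max_ge) (simp, rule range_eqI[of _ _ "(i, j, k, l)"], simp)

lemma birkhoff_eta_ge_1:
  fixes K :: "real ^ 'n::finite ^ 'm::finite"
  assumes "pos_mat K"
  shows "1 \<le> birkhoff_eta K"
proof -
  obtain i :: 'm and k :: 'n where True by simp
  have "K $ i $ k \<noteq> 0"
    using assms by (metis pos_mat_def less_irrefl)
  then show ?thesis
    using birkhoff_eta_ge[of K i k i k] by simp
qed

lemma pos_mat_transpose: "pos_mat K \<Longrightarrow> pos_mat (transpose K)"
  by (simp add: pos_mat_def transpose_def)

text \<open>Exchanging the pair of row indices with the pair of column indices only permutes the
  cross ratios, so both maxima run over the same set.\<close>

lemma birkhoff_eta_transpose: "birkhoff_eta (transpose K) = birkhoff_eta K"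
  for K :: "real ^ 'n::finite ^ 'm::finite"
proof -
  let ?f = "\<lambda>(i, j, k, l). (K $ i $ k * K $ j $ l) / (K $ j $ k * K $ i $ l)"
  let ?g = "\<lambda>(i, j, k, l). (transpose K $ i $ k * transpose K $ j $ l)
      / (transpose K $ j $ k * transpose K $ i $ l)"
  let ?swap = "\<lambda>(i, j, k, l). (k, l, i, j) :: 'm \<times> 'm \<times> 'n \<times> 'n"
  have "?g = ?f \<circ> ?swap"
    by (auto simp: transpose_def fun_eq_iff mult.commute)
  moreover have "range ?swap = UNIV"
    by (rule surjI[of _ "\<lambda>(k, l, i, j). (i, j, k, l)"]) auto
  ultimately have "range ?g = range ?f"
    using image_comp[of ?f ?swap UNIV] by argo
  then show ?thesis
    by (simp add: birkhoff_eta_def)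
qed

lemma birkhoff_ratio_transpose: "birkhoff_ratio (transpose K) = birkhoff_ratio K"
  for K :: "real ^ 'n::finite ^ 'm::finite"
  by (simp add: birkhoff_ratio_def birkhoff_eta_transpose)

lemma birkhoff_ratio_bounds:
  fixes K :: "real ^ 'n::finite ^ 'm::finite"
  assumes "pos_mat K"
  shows "0 \<le> birkhoff_ratio K" "birkhoff_ratio K < 1"
proof -
  define s where "s = sqrt (birkhoff_eta K)"
  have "1 \<le> s"
    using birkhoff_eta_ge_1[OF assms] by (simp add: s_def)
  then show "0 \<le> birkhoff_ratio K" "birkhoff_ratio K < 1"
    unfolding birkhoff_ratio_def s_def[symmetric] by simp_all
qed

text \<open>The norm of the image difference is attained at some pair of rows \<open>i\<close>,
  \<open>j\<close>. Rows of \<open>K\<close> have likelihood ratios bounded by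
  \<open>birkhoff_eta K\<close>, so \<open>ln_sum_ratio_le\<close> applies with
  \<open>s = sqrt (birkhoff_eta K)\<close>.\<close>

theorem birkhoff_contraction:
  fixes K :: "real ^ 'n::finite ^ 'm::finite"
  assumes K: "pos_mat K"
  shows "norm (mat_cls K x - mat_cls K y) \<le> birkhoff_ratio K * norm (x - y)"
proof -
  obtain v where v: "x = cls v" "pos_vec v" by (rule compositional_cases)
  obtain w where w: "y = cls w" "pos_vec w" by (rule compositional_cases)
  let ?z = "\<chi> k. v $ k / w $ k"
  let ?Z = "\<chi> i. (K *v v) $ i / (K *v w) $ i"
  have Kpos: "pos_vec (K *v v)" "pos_vec (K *v w)"
    using K v w by (auto intro: pos_vec_mat_mult)
  have pos: "pos_vec ?z" "pos_vec ?Z"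
    using v w Kpos by (auto simp: pos_vec_def)
  obtain i j where ij: "hilbert_norm (cls ?Z) = ln (?Z $ i) - ln (?Z $ j)"
    using hilbert_norm_attained[OF pos(2)] .
  have eta: "1 \<le> birkhoff_eta K"
    by (rule birkhoff_eta_ge_1[OF K])
  have "ln ((\<Sum>k\<in>UNIV. K $ i $ k * v $ k) / (\<Sum>k\<in>UNIV. K $ i $ k * w $ k))
      - ln ((\<Sum>k\<in>UNIV. K $ j $ k * v $ k) / (\<Sum>k\<in>UNIV. K $ j $ k * w $ k))
    \<le> (sqrt (birkhoff_eta K) - 1) / (sqrt (birkhoff_eta K) + 1) * hilbert_norm (cls ?z)"
  proof (rule ln_sum_ratio_le)
    fix k l
    show "K $ i $ k * K $ j $ l \<le> (sqrt (birkhoff_eta K))\<^sup>2 * (K $ j $ k * K $ i $ l)"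
      using birkhoff_eta_ge[of K i k j l] K eta by (simp add: pos_mat_def pos_divide_le_eq)
    show "ln (v $ k / w $ k) - ln (v $ l / w $ l) \<le> hilbert_norm (cls ?z)"
      using hilbert_norm_ge[OF pos(1), of k l] by simp
  qed (use K v w eta in \<open>auto simp: pos_mat_def pos_vec_def\<close>)
  then have "hilbert_norm (cls ?Z) \<le> birkhoff_ratio K * hilbert_norm (cls ?z)"
    unfolding ij by (simp add: matrix_vector_mult_def birkhoff_ratio_def)
  then show ?thesis
    using K v w Kpos by (simp add: mat_cls_cls cls_diff norm_compositional_def)
qed

section \<open>Errors of the relaxed half steps\<close>

lemma sinkhorn_solution_transpose:
  "sinkhorn_solution K a b u v \<Longrightarrow> sinkhorn_solution (transpose K) b a v u"
  unfolding sinkhorn_solution_def transpose_transpose by blast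

text \<open>In additive notation the scaling equation says that the solution is a fixed point of the
  relaxed update.\<close>

lemma cls_sinkhorn_solution:
  fixes K :: "real ^ 'n::finite ^ 'm::finite"
  assumes "pos_mat K" "sinkhorn_solution K a b u v"
  shows "cls a = cls u + mat_cls K (cls v)"
proof -
  have uv: "pos_vec u" "pos_vec v" and a: "a = u * (K *v v)"
    using assms(2) by (simp_all add: sinkhorn_solution_def)
  show ?thesis
    unfolding a mat_cls_cls[OF assms(1) uv(2)]
    by (rule cls_add[symmetric, OF uv(1) pos_vec_mat_mult[OF assms(1) uv(2)]])
qed

text \<open>Subtracting the fixed point identity leaves a multiple of the old error and a difference
  of two images under \<open>K\<close>, which contracts. Applied to the transpose, this also covers
  the update of \<open>v\<close>.\<close>

lemma norm_relaxed_half_step_le: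
  fixes K :: "real ^ 'n::finite ^ 'm::finite"
  assumes K: "pos_mat K" and sol: "sinkhorn_solution K a b us vs" and "0 \<le> \<omega>"
  shows "norm ((1 - \<omega>) *\<^sub>R u + \<omega> *\<^sub>R cls a - \<omega> *\<^sub>R mat_cls K v - cls us)
    \<le> \<bar>1 - \<omega>\<bar> * norm (u - cls us) + \<omega> * birkhoff_ratio K * norm (v - cls vs)"
proof -
  have "(1 - \<omega>) *\<^sub>R u + \<omega> *\<^sub>R cls a - \<omega> *\<^sub>R mat_cls K v - cls us
    = (1 - \<omega>) *\<^sub>R (u - cls us) - \<omega> *\<^sub>R (mat_cls K v - mat_cls K (cls vs))"
    unfolding cls_sinkhorn_solution[OF K sol] by (simp add: algebra_simps)
  also have "norm \<dots> \<le> norm ((1 - \<omega>) *\<^sub>R (u - cls us))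
      + norm (\<omega> *\<^sub>R (mat_cls K v - mat_cls K (cls vs)))"
    by (rule norm_triangle_ineq4)
  also have "\<dots> \<le> \<bar>1 - \<omega>\<bar> * norm (u - cls us) + \<omega> * (birkhoff_ratio K * norm (v - cls vs))"
    using \<open>0 \<le> \<omega>\<close> birkhoff_contraction[OF K, of v "cls vs"] by (simp add: mult_left_mono)
  finally show ?thesis
    by (simp add: mult.assoc)
qed

section \<open>Exponential convergence\<close>

theorem theorem3:
  fixes K :: "real ^ 'n ^ 'm"
    and a us :: "real ^ 'm" and b vs :: "real ^ 'n"
    and \<omega> :: real
    and u :: "nat \<Rightarrow> 'm compositional" and v :: "nat \<Rightarrow> 'n compositional"
  assumes "CARD('m) \<ge> 2" and "CARD('n) \<ge> 2"
    and "pos_vec a" and "prob_vec a"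
    and "pos_vec b" and "prob_vec b"
    and "pos_mat K"
    and "sinkhorn_solution K a b us vs"
    and "0 < \<omega>" and "\<omega> < 2 / (1 + birkhoff_ratio K)"
    and "\<And>l. u (Suc l) = (1 - \<omega>) *\<^sub>R u l + \<omega> *\<^sub>R cls a - \<omega> *\<^sub>R mat_cls K (v l)"
    and "\<And>l. v (Suc l) = (1 - \<omega>) *\<^sub>R v l + \<omega> *\<^sub>R cls b
                          - \<omega> *\<^sub>R mat_cls (transpose K) (u (Suc l))"
  shows "\<exists>C\<ge>0. \<exists>q. 0 < q \<and> q < 1 \<and>
           (\<forall>l. norm (u l - cls us) + norm (v l - cls vs) \<le> C * q ^ l)"
proof -
  note K = assms(7) and sol = assms(8) and u_Suc = assms(11) and v_Suc = assms(12)
  define X where "X = (\<lambda>l. norm (u l - cls us))"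
  define Y where "Y = (\<lambda>l. norm (v l - cls vs))"
  define \<alpha> where "\<alpha> = \<bar>1 - \<omega>\<bar>"
  define \<beta> where "\<beta> = \<omega> * birkhoff_ratio K"
  define M where "M = max (X 0) (Y 0)"
  \<comment> \<open>\<open>\<alpha> + \<beta>\<close> itself vanishes when \<open>\<omega> = 1\<close> and \<open>K\<close> has rank one.\<close>
  define q where "q = max (\<alpha> + \<beta>) (1 / 2)"
  note ratio = birkhoff_ratio_bounds[OF K]
  have "0 \<le> X 0"
    by (simp add: X_def)
  then have nonneg: "0 \<le> \<alpha>" "0 \<le> \<beta>" "0 \<le> M"
    using ratio \<open>0 < \<omega>\<close> by (simp_all add: \<alpha>_def \<beta>_def M_def le_max_iff_disj)
  have "\<beta> < \<omega>"
    using mult_strict_left_mono[OF ratio(2) \<open>0 < \<omega>\<close>] by (simp add: \<beta>_def)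
  moreover have "\<omega> + \<beta> < 2"
    using ratio \<open>\<omega> < 2 / (1 + birkhoff_ratio K)\<close>
    by (simp add: \<beta>_def pos_less_divide_eq distrib_left)
  \<comment> \<open>For \<open>\<omega> \<le> 1\<close> this is \<open>\<beta> < \<omega>\<close>;
    for \<open>\<omega> > 1\<close> it is \<open>\<omega> + \<beta> < 2\<close>.\<close>
  ultimately have "\<alpha> + \<beta> < 1"
    by (simp add: \<alpha>_def abs_if)
  then have q: "0 < q" "q < 1" "\<alpha> + \<beta> \<le> q"
    by (auto simp: q_def)
  have combine: "\<alpha> * x + \<beta> * y \<le> q * B" if "x \<le> B" "y \<le> B" "0 \<le> B" for x y B
  proof -
    have "\<alpha> * x + \<beta> * y \<le> \<alpha> * B + \<beta> * B"
      using that nonneg by (intro add_mono mult_left_mono)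
    also have "\<dots> \<le> q * B"
      using mult_right_mono[OF q(3) that(3)] by (simp add: distrib_right)
    finally show ?thesis .
  qed
  have stepX: "X (Suc l) \<le> \<alpha> * X l + \<beta> * Y l" for l
    unfolding X_def Y_def \<alpha>_def \<beta>_def u_Suc[of l]
    using norm_relaxed_half_step_le[OF K sol] \<open>0 < \<omega>\<close> by simp
  have stepY: "Y (Suc l) \<le> \<alpha> * Y l + \<beta> * X (Suc l)" for l
    unfolding X_def Y_def \<alpha>_def \<beta>_def v_Suc[of l]
    using norm_relaxed_half_step_le[OF pos_mat_transpose[OF K] sinkhorn_solution_transpose[OF sol]]
      \<open>0 < \<omega>\<close>
    by (simp add: birkhoff_ratio_transpose)
  have bound: "X l \<le> M * q ^ l \<and> Y l \<le> M * q ^ l" for l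
  proof (induction l)
    case 0
    then show ?case by (simp add: M_def)
  next
    case (Suc l)
    let ?B = "M * q ^ l"
    have B: "0 \<le> ?B" using nonneg q by simp
    have X: "X (Suc l) \<le> q * ?B"
      using stepX[of l] combine[of "X l" ?B "Y l"] Suc B by simp
    \<comment> \<open>The update of \<open>v\<close> uses the new \<open>u\<close>, whose error is
      already smaller; the weaker bound \<open>?B\<close> suffices, as \<open>combine\<close>
      supplies the factor \<open>q\<close>.\<close>
    also have "\<dots> \<le> ?B"
      using q B by (intro mult_left_le_one_le) auto
    finally have "Y (Suc l) \<le> q * ?B"
      using stepY[of l] combine[of "Y l" ?B "X (Suc l)"] Suc B by simp
    with X show ?case by (simp add: mult_ac)
  qed
  have "X l + Y l \<le> 2 * M * q ^ l" for l
    using bound[of l] by simp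
  then show ?thesis
    using q nonneg unfolding X_def Y_def by (intro exI[of _ "2 * M"] conjI exI[of _ q]) auto
qed

end
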